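(* Let $G$ be any of the sequent calculi $\mathbf{GCE}$, $\mathbf{GCM}$, $\mathbf{GCMC}$, $\mathbf{GCEN}$, $\mathbf{GCMN}$, $\mathbf{GCK}$. Then the cut rule is admissible in $G$: if $G\vdash\Gamma_1\Rightarrow\phi,\Delta_1$ and $G\vdash\phi,\Gamma_2\Rightarrow\Delta_2$, then $G\vdash\Gamma_1,\Gamma_2\Rightarrow\Delta_1,\Delta_2$.
   Context: Formulas are those of $\mathcal{L}_\triangleright$: built from atoms and $\bot$ with $\wedge,\vee,\to$ and the binary $\triangleright$. A sequent is $\Gamma\Rightarrow\Delta$ with $\Gamma,\Delta$ finite multisets of formulas. $\mathbf{G3cp}$ has axioms $\Gamma,p\Rightarrow p,\Delta$ ($p$ atomic) and $\Gamma,\bot\Rightarrow\Delta$, and rules: $(L\wedge)$ from $\Gamma,\phi,\psi\Rightarrow\Delta$ infer $\Gamma,\phi\wedge\psi\Rightarrow\Delta$; $(R\wedge)$ from $\Gamma\Rightarrow\phi,\Delta$ and $\Gamma\Rightarrow\psi,\Delta$ infer $\Gamma\Rightarrow\phi\wedge\psi,\Delta$; $(L\vee)$ from $\Gamma,\phi\Rightarrow\Delta$ and $\Gamma,\psi\Rightarrow\Delta$ infer $\Gamma,\phi\vee\psi\Rightarrow\Delta$; $(R\vee)$ from $\Gamma\Rightarrow\phi,\psi,\Delta$ infer $\Gamma\Rightarrow\phi\vee\psi,\Delta$; $(L\to)$ from $\Gamma\Rightarrow\phi,\Delta$ and $\Gamma,\psi\Rightarrow\Delta$ infer $\Gamma,\phi\to\psi\Rightarrow\Delta$;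 $(R\to)$ from $\Gamma,\phi\Rightarrow\psi,\Delta$ infer $\Gamma\Rightarrow\phi\to\psi,\Delta$. $\mathbf{G3W}$ is $\mathbf{G3cp}$ plus weakening: from $\Gamma\Rightarrow\Delta$ infer $\Gamma,\phi\Rightarrow\Delta$, resp. $\Gamma\Rightarrow\phi,\Delta$. Write "$\alpha\Leftrightarrow\beta$" as a premise for the two premises $\alpha\Rightarrow\beta$ and $\beta\Rightarrow\alpha$. Conditional rules (no extra context in the conclusion): $(CE)$ from $\phi_0\Leftrightarrow\phi_1$ and $\psi_0\Leftrightarrow\psi_1$ infer $\phi_1\triangleright\psi_1\Rightarrow\phi_0\triangleright\psi_0$; $(CM)$ from $\phi_0\Leftrightarrow\phi_1$ and $\psi_1\Rightarrow\psi_0$ infer $\phi_1\triangleright\psi_1\Rightarrow\phi_0\triangleright\psi_0$; $(CMC)$ for $n\ge1$, from $\phi_0\Leftrightarrow\phi_i$ ($1\le i\le n$) and $\psi_1,\dots,\psi_n\Rightarrow\psi_0$ infer $\phi_1\triangleright\psi_1,\dots,\phi_n\triangleright\psi_n\Rightarrow\phi_0\triangleright\psi_0$; $(CN)$ from $\Rightarrow\psi_0$ infer $\Rightarrow\phi_0\triangleright\psi_0$. $\mathbf{GCE},\mathbf{GCM},\mathbf{GCMC}$ are $\mathbf{G3W}$ plus $(CE)$, $(CM)$, $(CMC)$ respectively; $\mathbf{GCEN},\mathbf{GCMN},\mathbf{GCK}$ are $\mathbf{GCE},\mathbf{GCM},\mathbf{GCMC}$ plus $(CN)$. The cut rule is not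 part of these calculi. *)

theory Defs
  imports Main "HOL-Library.Multiset"
begin

datatype 'a fm =
    Atm 'a
  | Bot
  | Conj "'a fm" "'a fm"
  | Disj "'a fm" "'a fm"
  | Imp "'a fm" "'a fm"
  | Cond "'a fm" "'a fm"

datatype calculus = GCE | GCM | GCMC | GCEN | GCMN | GCK

definition has_CE :: "calculus \<Rightarrow> bool" where
  "has_CE G \<longleftrightarrow> G \<in> {GCE, GCEN}"

definition has_CM :: "calculus \<Rightarrow> bool" where
  "has_CM G \<longleftrightarrow> G \<in> {GCM, GCMN}"

definition has_CMC :: "calculus \<Rightarrow> bool" where
  "has_CMC G \<longleftrightarrow> G \<in> {GCMC, GCK}"

definition has_CN :: "calculus \<Rightarrow> bool" where
  "has_CN G \<longleftrightarrow> G \<in> {GCEN, GCMN, GCK}"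

inductive derivable :: "calculus \<Rightarrow> 'a fm multiset \<Rightarrow> 'a fm multiset \<Rightarrow> bool"
  for G :: calculus where
  ax: "derivable G (add_mset (Atm p) \<Gamma>) (add_mset (Atm p) \<Delta>)"
| axBot: "derivable G (add_mset Bot \<Gamma>) \<Delta>"
| LConj: "derivable G (add_mset \<phi> (add_mset \<psi> \<Gamma>)) \<Delta> \<Longrightarrow>
          derivable G (add_mset (Conj \<phi> \<psi>) \<Gamma>) \<Delta>"
| RConj: "derivable G \<Gamma> (add_mset \<phi> \<Delta>) \<Longrightarrow> derivable G \<Gamma> (add_mset \<psi> \<Delta>) \<Longrightarrow>
          derivable G \<Gamma> (add_mset (Conj \<phi> \<psi>) \<Delta>)"
| LDisj: "derivable G (add_mset \<phi> \<Gamma>) \<Delta> \<Longrightarrow> derivable G (add_mset \<psi> \<Gamma>) \<Delta> \<Longrightarrow>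
          derivable G (add_mset (Disj \<phi> \<psi>) \<Gamma>) \<Delta>"
| RDisj: "derivable G \<Gamma> (add_mset \<phi> (add_mset \<psi> \<Delta>)) \<Longrightarrow>
          derivable G \<Gamma> (add_mset (Disj \<phi> \<psi>) \<Delta>)"
| LImp: "derivable G \<Gamma> (add_mset \<phi> \<Delta>) \<Longrightarrow> derivable G (add_mset \<psi> \<Gamma>) \<Delta> \<Longrightarrow>
          derivable G (add_mset (Imp \<phi> \<psi>) \<Gamma>) \<Delta>"
| RImp: "derivable G (add_mset \<phi> \<Gamma>) (add_mset \<psi> \<Delta>) \<Longrightarrow>
          derivable G \<Gamma> (add_mset (Imp \<phi> \<psi>) \<Delta>)"
| LW: "derivable G \<Gamma> \<Delta> \<Longrightarrow> derivable G (add_mset \<phi> \<Gamma>) \<Delta>"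
| RW: "derivable G \<Gamma> \<Delta> \<Longrightarrow> derivable G \<Gamma> (add_mset \<phi> \<Delta>)"
| CE: "has_CE G \<Longrightarrow>
       derivable G {#\<phi>0#} {#\<phi>1#} \<Longrightarrow> derivable G {#\<phi>1#} {#\<phi>0#} \<Longrightarrow>
       derivable G {#\<psi>0#} {#\<psi>1#} \<Longrightarrow> derivable G {#\<psi>1#} {#\<psi>0#} \<Longrightarrow>
       derivable G {#Cond \<phi>1 \<psi>1#} {#Cond \<phi>0 \<psi>0#}"
| CM: "has_CM G \<Longrightarrow>
       derivable G {#\<phi>0#} {#\<phi>1#} \<Longrightarrow> derivable G {#\<phi>1#} {#\<phi>0#} \<Longrightarrow>
       derivable G {#\<psi>1#} {#\<psi>0#} \<Longrightarrow>
       derivable G {#Cond \<phi>1 \<psi>1#} {#Cond \<phi>0 \<psi>0#}"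
| CMC: "has_CMC G \<Longrightarrow> n \<ge> 1 \<Longrightarrow>
       (\<forall>i\<in>{1..n}. derivable G {#\<phi>0#} {#\<phi> i#} \<and> derivable G {#\<phi> i#} {#\<phi>0#}) \<Longrightarrow>
       derivable G (mset (map \<psi> [1..<Suc n])) {#\<psi>0#} \<Longrightarrow>
       derivable G (mset (map (\<lambda>i. Cond (\<phi> i) (\<psi> i)) [1..<Suc n])) {#Cond \<phi>0 \<psi>0#}"
| CN: "has_CN G \<Longrightarrow> derivable G {#} {#\<psi>0#} \<Longrightarrow>
       derivable G {#} {#Cond \<phi>0 \<psi>0#}"

end

theory Submission
  imports Defs
begin

text \<open>
  No derivation heights are needed. In the presence of weakening it suffices to prove the
  context-sharing cut, by induction on the cut formula. For a propositional connective, invertibility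
  of its rules reduces the cut directly to cuts on the immediate subformulas. The same
  argument gives contraction, so derivability depends only on the underlying sets of formulas. For an
  atom or a conditional, an induction on the left and then on the right derivation, with contexts
  compared as sets, leaves two matching conditional rules. All conditional rules are instances of one
  schema, and such instances compose by cuts on the two immediate subformulas.
\<close>

section \<open>Propositional rules read off from their principal formula\<close>

definition propositional :: "'a fm \<Rightarrow> bool" where
  "propositional C \<longleftrightarrow> (\<forall>p. C \<noteq> Atm p) \<and> (\<forall>A B. C \<noteq> Cond A B)"

text \<open>Each pair holds what one premise adds to the shared context, on the left and on the
  right. For \<open>Bot\<close> the empty set is an axiom, a rule with no premises. For atoms and
  conditionals it means that there is no such rule, so every use of the table is guarded by
  \<open>propositional\<close>.\<close>

fun left_premises :: "'a fm \<Rightarrow> ('a fm multiset \<times> 'a fm multiset) set" where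
  "left_premises (Conj A B) = {({#A, B#}, {#})}"
| "left_premises (Disj A B) = {({#A#}, {#}), ({#B#}, {#})}"
| "left_premises (Imp A B) = {({#}, {#A#}), ({#B#}, {#})}"
| "left_premises _ = {}"

text \<open>Introducing \<open>\<bottom>\<close> on the right is weakening, viewed as a rule with one premise.\<close>

fun right_premises :: "'a fm \<Rightarrow> ('a fm multiset \<times> 'a fm multiset) set" where
  "right_premises (Conj A B) = {({#}, {#A#}), ({#}, {#B#})}"
| "right_premises (Disj A B) = {({#}, {#A, B#})}"
| "right_premises (Imp A B) = {({#A#}, {#B#})}"
| "right_premises Bot = {({#}, {#})}"
| "right_premises _ = {}"

lemma derivable_left:
  assumes "propositional C"
    and "\<And>L R. (L, R) \<in> left_premises C \<Longrightarrow> derivable G (L + \<Gamma>) (R + \<Delta>)"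
  shows "derivable G (add_mset C \<Gamma>) \<Delta>"
proof -
  have "\<forall>(L, R) \<in> left_premises C. derivable G (L + \<Gamma>) (R + \<Delta>)"
    using assms(2) by blast
  with assms(1) show ?thesis
    by (cases C)
      (auto simp: propositional_def intro: derivable.axBot derivable.LConj derivable.LDisj derivable.LImp)
qed

lemma derivable_right:
  assumes "propositional C"
    and "\<And>L R. (L, R) \<in> right_premises C \<Longrightarrow> derivable G (L + \<Gamma>) (R + \<Delta>)"
  shows "derivable G \<Gamma> (add_mset C \<Delta>)"
proof -
  have "\<forall>(L, R) \<in> right_premises C. derivable G (L + \<Gamma>) (R + \<Delta>)"
    using assms(2) by blast
  with assms(1) show ?thesis
    by (cases C)
      (auto simp: propositional_def intro: derivable.RW derivable.RConj derivable.RDisj derivable.RImp)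
qed

section \<open>A uniform schema for the conditional rules\<close>

text \<open>
  \<open>n\<close> counts the conditionals in the antecedent of the conclusion: \<open>n = 0\<close> is the rule (CN), and all six
  calculi have an instance with \<open>n = 1\<close>, by (CE), (CM) or (CMC).
\<close>

definition cond_arity :: "calculus \<Rightarrow> nat \<Rightarrow> bool" where
  "cond_arity G n \<longleftrightarrow> n = 0 \<and> has_CN G \<or> n = 1 \<or> 1 \<le> n \<and> has_CMC G"

text \<open>\<open>M\<close> collects the pairs behind the conditionals of the antecedent. The
  entailment from \<open>B\<close> back to \<open>B'\<close> is what separates (CE) from (CM), hence
  the guard \<open>has_CE G\<close>.\<close>

definition cond_premises ::
    "calculus \<Rightarrow> ('a fm \<times> 'a fm) multiset \<Rightarrow> 'a fm \<Rightarrow> 'a fm \<Rightarrow> bool" where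
  "cond_premises G M A B \<longleftrightarrow> cond_arity G (size M) \<and>
     (\<forall>(A', B') \<in># M. derivable G {#A#} {#A'#} \<and> derivable G {#A'#} {#A#} \<and>
        (has_CE G \<longrightarrow> derivable G {#B#} {#B'#})) \<and>
     derivable G (image_mset snd M) {#B#}"

lemma derivable_cond:
  assumes "cond_premises G M A B"
  shows "derivable G (image_mset (case_prod Cond) M) {#Cond A B#}"
proof -
  obtain xs where xs: "M = mset xs"
    by (metis ex_mset)
  have eqv: "derivable G {#A#} {#A'#} \<and> derivable G {#A'#} {#A#}"
    and bwd: "has_CE G \<Longrightarrow> derivable G {#B#} {#B'#}" if "(A', B') \<in># M" for A' B'
    using assms that by (auto simp: cond_premises_def)
  have main: "derivable G (image_mset snd M) {#B#}" and "cond_arity G (size M)"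
    using assms by (auto simp: cond_premises_def)
  then consider "M = {#}" "has_CN G" | "size M = 1" "\<not> has_CMC G" | "1 \<le> size M" "has_CMC G"
    by (fastforce simp: cond_arity_def)
  then show ?thesis
  proof cases
    case 1
    then show ?thesis using main by (auto intro: derivable.CN)
  next
    case 2
    then obtain A' B' where M: "M = {#(A', B')#}"
      by (metis One_nat_def size_1_singleton_mset surj_pair)
    have "has_CE G \<or> has_CM G"
      using 2 by (cases G) (auto simp: has_CE_def has_CM_def has_CMC_def)
    then show ?thesis
      using main eqv bwd by (auto simp: M intro: derivable.CE derivable.CM)
  next
    case 3
    \<comment> \<open>(CMC) numbers its premises from 1 and list positions start at 0, hence the
      shift by one.\<close>
    let ?\<phi> = "\<lambda>i. fst (xs ! (i - 1))" and ?\<psi> = "\<lambda>i. snd (xs ! (i - 1))"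
    have shift: "map (\<lambda>i. f (xs ! (i - 1))) [1..<Suc (length xs)] = map f xs" for f :: "_ \<Rightarrow> 'a fm"
      by (rule nth_equalityI) (auto simp del: upt_Suc)
    have "\<forall>i\<in>{1..length xs}. derivable G {#A#} {#?\<phi> i#} \<and> derivable G {#?\<phi> i#} {#A#}"
    proof
      fix i assume "i \<in> {1..length xs}"
      then have "xs ! (i - 1) \<in># M" by (auto simp: xs)
      then show "derivable G {#A#} {#?\<phi> i#} \<and> derivable G {#?\<phi> i#} {#A#}"
        by (metis eqv prod.collapse)
    qed
    moreover have "derivable G (mset (map ?\<psi> [1..<Suc (length xs)])) {#B#}"
      using main by (simp only: shift) (simp add: xs)
    ultimately have "derivable G
        (mset (map (\<lambda>i. Cond (?\<phi> i) (?\<psi> i)) [1..<Suc (length xs)])) {#Cond A B#}"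
      using 3 by (intro derivable.CMC) (auto simp: xs)
    moreover have "map (\<lambda>i. Cond (?\<phi> i) (?\<psi> i)) [1..<Suc (length xs)] = map (case_prod Cond) xs"
      using shift[of "case_prod Cond"] by (simp only: case_prod_beta)
    ultimately show ?thesis
      by (simp only: xs mset_map)
  qed
qed

text \<open>This rule reduces the later inductions to six cases: all propositional rules, with the
  axiom for \<open>Bot\<close>, fall under \<open>Left\<close> and \<open>Right\<close>, and (CE),
  (CM), (CMC), (CN) under \<open>Cond\<close>.\<close>

lemma derivable_schema_induct [consumes 1, case_names Ax Left Right LW RW Cond]:
  assumes "derivable G \<Gamma> \<Delta>"
    and Ax: "\<And>p \<Gamma> \<Delta>. P (add_mset (Atm p) \<Gamma>) (add_mset (Atm p) \<Delta>)"
    and Left: "\<And>C \<Gamma> \<Delta>. propositional C \<Longrightarrow>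
      (\<And>L R. (L, R) \<in> left_premises C \<Longrightarrow> derivable G (L + \<Gamma>) (R + \<Delta>)) \<Longrightarrow>
      (\<And>L R. (L, R) \<in> left_premises C \<Longrightarrow> P (L + \<Gamma>) (R + \<Delta>)) \<Longrightarrow> P (add_mset C \<Gamma>) \<Delta>"
    and Right: "\<And>C \<Gamma> \<Delta>. propositional C \<Longrightarrow>
      (\<And>L R. (L, R) \<in> right_premises C \<Longrightarrow> derivable G (L + \<Gamma>) (R + \<Delta>)) \<Longrightarrow>
      (\<And>L R. (L, R) \<in> right_premises C \<Longrightarrow> P (L + \<Gamma>) (R + \<Delta>)) \<Longrightarrow> P \<Gamma> (add_mset C \<Delta>)"
    and LW: "\<And>C \<Gamma> \<Delta>. derivable G \<Gamma> \<Delta> \<Longrightarrow> P \<Gamma> \<Delta> \<Longrightarrow> P (add_mset C \<Gamma>) \<Delta>"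
    and RW: "\<And>C \<Gamma> \<Delta>. derivable G \<Gamma> \<Delta> \<Longrightarrow> P \<Gamma> \<Delta> \<Longrightarrow> P \<Gamma> (add_mset C \<Delta>)"
    and Cond: "\<And>M A B. cond_premises G M A B \<Longrightarrow>
      P (image_mset (case_prod Cond) M) {#Cond A B#}"
  shows "P \<Gamma> \<Delta>"
  using assms(1)
proof (induction rule: derivable.induct)
  case (CE \<phi>0 \<phi>1 \<psi>0 \<psi>1)
  then show ?case
    using Cond[of "{#(\<phi>1, \<psi>1)#}" \<phi>0 \<psi>0] by (auto simp: cond_premises_def cond_arity_def)
next
  case (CM \<phi>0 \<phi>1 \<psi>1 \<psi>0)
  have "\<not> has_CE G"
    using CM(1) by (auto simp: has_CE_def has_CM_def)
  then show ?case
    using CM Cond[of "{#(\<phi>1, \<psi>1)#}" \<phi>0 \<psi>0] by (auto simp: cond_premises_def cond_arity_def)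
next
  case (CMC n \<phi>0 \<phi> \<psi> \<psi>0)
  have "\<not> has_CE G"
    using CMC(1) by (auto simp: has_CE_def has_CMC_def)
  then have "cond_premises G (mset (map (\<lambda>i. (\<phi> i, \<psi> i)) [1..<Suc n])) \<phi>0 \<psi>0"
    using CMC by (auto simp: cond_premises_def cond_arity_def multiset.map_comp comp_def
        simp del: upt_Suc)
  from Cond[OF this] show ?case
    by (simp add: multiset.map_comp comp_def del: upt_Suc)
next
  case (CN \<psi>0 \<phi>0)
  then show ?case
    using Cond[of "{#}" \<phi>0 \<psi>0] by (auto simp: cond_premises_def cond_arity_def)
next
  case (axBot \<Gamma> \<Delta>)
  show ?case by (rule Left) (auto simp: propositional_def)
next
  case (LConj \<phi> \<psi> \<Gamma> \<Delta>)
  then show ?case by (intro Left) (auto simp: propositional_def)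
next
  case (RConj \<Gamma> \<phi> \<Delta> \<psi>)
  then show ?case by (intro Right) (auto simp: propositional_def)
next
  case (LDisj \<phi> \<Gamma> \<Delta> \<psi>)
  then show ?case by (intro Left) (auto simp: propositional_def)
next
  case (RDisj \<Gamma> \<phi> \<psi> \<Delta>)
  then show ?case by (intro Right) (auto simp: propositional_def)
next
  case (LImp \<Gamma> \<phi> \<Delta> \<psi>)
  then show ?case by (intro Left) (auto simp: propositional_def)
next
  case (RImp \<phi> \<Gamma> \<psi> \<Delta>)
  then show ?case by (intro Right) (auto simp: propositional_def)
qed (fact Ax LW RW)+

section \<open>Weakening and invertibility\<close>

lemma derivable_weaken_plus:
  assumes "derivable G \<Gamma> \<Delta>"
  shows "derivable G (\<Gamma>' + \<Gamma>) (\<Delta>' + \<Delta>)"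
proof -
  have "derivable G (\<Gamma>' + \<Gamma>) \<Delta>"
    by (induction \<Gamma>') (auto intro: assms derivable.LW)
  then show ?thesis
    by (induction \<Delta>') (auto intro: derivable.RW)
qed

text \<open>If \<open>C\<close> is principal, a premise is the result; if it came by weakening,
  weakening by \<open>L\<close> and \<open>R\<close> replaces that step. Otherwise \<open>C\<close>
  is passed up to the premises. Conclusions of conditional rules contain only conditionals, so
  \<open>C\<close> is not among them. Membership and subtraction keep the antecedent a variable, as
  the induction requires.\<close>

lemma invert_left:
  assumes "derivable G \<Gamma> \<Delta>" "C \<in># \<Gamma>" "propositional C" "(L, R) \<in> left_premises C"
  shows "derivable G (L + (\<Gamma> - {#C#})) (R + \<Delta>)"
  using assms(1,2)
proof (induction rule: derivable_schema_induct)
  case (Ax p \<Gamma> \<Delta>)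
  have "C \<noteq> Atm p" using assms(3) by (auto simp: propositional_def)
  then show ?case
    by (simp add: derivable.ax)
next
  case (Left X \<Gamma> \<Delta>)
  show ?case
  proof (cases "X = C")
    case True
    then show ?thesis using Left assms(4) by simp
  next
    case False
    then have C: "C \<in># \<Gamma>" using Left by simp
    have "derivable G (add_mset X (L + (\<Gamma> - {#C#}))) (R + \<Delta>)"
    proof (rule derivable_left[OF Left(1)])
      fix L' R' assume "(L', R') \<in> left_premises X"
      then have "derivable G (L + (L' + \<Gamma> - {#C#})) (R + (R' + \<Delta>))"
        by (rule Left(3)) (simp add: C)
      then show "derivable G (L' + (L + (\<Gamma> - {#C#}))) (R' + (R + \<Delta>))"
        unfolding diff_union_single_conv[OF C] by (simp only: ac_simps)
    qed
    then show ?thesis using False by simp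
  qed
next
  case (Right X \<Gamma> \<Delta>)
  have "derivable G (L + (\<Gamma> - {#C#})) (add_mset X (R + \<Delta>))"
  proof (rule derivable_right[OF Right(1)])
    fix L' R' assume "(L', R') \<in> right_premises X"
    then have "derivable G (L + (L' + \<Gamma> - {#C#})) (R + (R' + \<Delta>))"
      by (rule Right(3)) (simp add: Right(4))
    then show "derivable G (L' + (L + (\<Gamma> - {#C#}))) (R' + (R + \<Delta>))"
      unfolding diff_union_single_conv[OF Right(4)] by (simp only: ac_simps)
  qed
  then show ?case by simp
next
  case (LW X \<Gamma> \<Delta>)
  show ?case
  proof (cases "X = C")
    case True
    then show ?thesis using LW(1) by (simp add: derivable_weaken_plus)
  next
    case False
    then show ?thesis using LW by (simp add: derivable.LW)
  qed
next
  case (RW X \<Gamma> \<Delta>)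
  then show ?case by (simp add: derivable.RW)
next
  case (Cond M A B)
  then show ?case using assms(3) by (auto simp: propositional_def)
qed

text \<open>The mirror image of \<open>invert_left\<close>. For \<open>Bot\<close> it deletes a
  succedent occurrence, which later settles the cut on \<open>Bot\<close>.\<close>

lemma invert_right:
  assumes "derivable G \<Gamma> \<Delta>" "C \<in># \<Delta>" "propositional C" "(L, R) \<in> right_premises C"
  shows "derivable G (L + \<Gamma>) (R + (\<Delta> - {#C#}))"
  using assms(1,2)
proof (induction rule: derivable_schema_induct)
  case (Ax p \<Gamma> \<Delta>)
  have "C \<noteq> Atm p" using assms(3) by (auto simp: propositional_def)
  then show ?case
    by (simp add: derivable.ax)
next
  case (Right X \<Gamma> \<Delta>)
  show ?case
  proof (cases "X = C")
    case True
    then show ?thesis using Right assms(4) by simp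
  next
    case False
    then have C: "C \<in># \<Delta>" using Right by simp
    have "derivable G (L + \<Gamma>) (add_mset X (R + (\<Delta> - {#C#})))"
    proof (rule derivable_right[OF Right(1)])
      fix L' R' assume "(L', R') \<in> right_premises X"
      then have "derivable G (L + (L' + \<Gamma>)) (R + (R' + \<Delta> - {#C#}))"
        by (rule Right(3)) (simp add: C)
      then show "derivable G (L' + (L + \<Gamma>)) (R' + (R + (\<Delta> - {#C#})))"
        unfolding diff_union_single_conv[OF C] by (simp only: ac_simps)
    qed
    then show ?thesis using False by simp
  qed
next
  case (Left X \<Gamma> \<Delta>)
  have "derivable G (add_mset X (L + \<Gamma>)) (R + (\<Delta> - {#C#}))"
  proof (rule derivable_left[OF Left(1)])
    fix L' R' assume "(L', R') \<in> left_premises X"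
    then have "derivable G (L + (L' + \<Gamma>)) (R + (R' + \<Delta> - {#C#}))"
      by (rule Left(3)) (simp add: Left(4))
    then show "derivable G (L' + (L + \<Gamma>)) (R' + (R + (\<Delta> - {#C#})))"
      unfolding diff_union_single_conv[OF Left(4)] by (simp only: ac_simps)
  qed
  then show ?case by simp
next
  case (RW X \<Gamma> \<Delta>)
  show ?case
  proof (cases "X = C")
    case True
    then show ?thesis using RW(1) by (simp add: derivable_weaken_plus)
  next
    case False
    then show ?thesis using RW by (simp add: derivable.RW)
  qed
next
  case (LW X \<Gamma> \<Delta>)
  then show ?case by (simp add: derivable.LW)
next
  case (Cond M A B)
  then show ?case using assms(3) by (auto simp: propositional_def)
qed

lemma invert_left_add:
  assumes "derivable G (add_mset C \<Gamma>) \<Delta>" "propositional C" "(L, R) \<in> left_premises C"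
  shows "derivable G (L + \<Gamma>) (R + \<Delta>)"
  using invert_left[OF assms(1) _ assms(2,3)] by simp

lemma invert_right_add:
  assumes "derivable G \<Gamma> (add_mset C \<Delta>)" "propositional C" "(L, R) \<in> right_premises C"
  shows "derivable G (L + \<Gamma>) (R + \<Delta>)"
  using invert_right[OF assms(1) _ assms(2,3)] by simp

section \<open>Contraction\<close>

definition contractible :: "calculus \<Rightarrow> 'a fm \<Rightarrow> bool" where
  "contractible G C \<longleftrightarrow>
     (\<forall>\<Gamma> \<Delta>. derivable G (add_mset C (add_mset C \<Gamma>)) \<Delta> \<longrightarrow> derivable G (add_mset C \<Gamma>) \<Delta>) \<and>
     (\<forall>\<Gamma> \<Delta>. derivable G \<Gamma> (add_mset C (add_mset C \<Delta>)) \<longrightarrow> derivable G \<Gamma> (add_mset C \<Delta>))"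

lemma contract_plus:
  assumes "derivable G (L + (L + \<Gamma>)) (R + (R + \<Delta>))"
    and "\<And>C. C \<in># L + R \<Longrightarrow> contractible G C"
  shows "derivable G (L + \<Gamma>) (R + \<Delta>)"
proof -
  have "derivable G (L + \<Gamma>) (R + (R + \<Delta>))"
    using assms
  proof (induction L arbitrary: \<Gamma>)
    case (add C L)
    then have "derivable G (add_mset C (add_mset C (L + (L + \<Gamma>)))) (R + (R + \<Delta>))"
      by simp
    then have "derivable G (add_mset C (L + (L + \<Gamma>))) (R + (R + \<Delta>))"
      using add.prems(2)[of C] by (auto simp: contractible_def)
    \<comment> \<open>The remaining copy of \<open>C\<close> joins the context, so the induction
      hypothesis must hold for all contexts.\<close>
    then show ?case
      using add.IH[of "add_mset C \<Gamma>"] add.prems(2) by simp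
  qed simp
  then show ?thesis
    using assms(2)
  proof (induction R arbitrary: \<Delta>)
    case (add C R)
    then have "derivable G (L + \<Gamma>) (add_mset C (add_mset C (R + (R + \<Delta>))))"
      by simp
    then have "derivable G (L + \<Gamma>) (add_mset C (R + (R + \<Delta>)))"
      using add.prems(2)[of C] by (auto simp: contractible_def)
    then show ?case
      using add.IH[of "add_mset C \<Delta>"] add.prems(2) by simp
  qed simp
qed

text \<open>Inverting both copies of \<open>C\<close> doubles the active formulas of each premise.
  These are immediate subformulas, hence contractible, and a single application of the rule restores
  \<open>C\<close>.\<close>

lemma contractible_propositional:
  assumes pC: "propositional C"
    and IH: "\<And>L R D. (L, R) \<in> left_premises C \<union> right_premises C \<Longrightarrow> D \<in># L + R \<Longrightarrow>
      contractible G D"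
  shows "contractible G C"
  unfolding contractible_def
proof (intro conjI allI impI)
  fix \<Gamma> \<Delta>
  assume d: "derivable G (add_mset C (add_mset C \<Gamma>)) \<Delta>"
  show "derivable G (add_mset C \<Gamma>) \<Delta>"
  proof (rule derivable_left[OF pC])
    fix L R assume LR: "(L, R) \<in> left_premises C"
    have "derivable G (add_mset C (L + \<Gamma>)) (R + \<Delta>)"
      using invert_left_add[OF d pC LR] by simp
    from invert_left_add[OF this pC LR] show "derivable G (L + \<Gamma>) (R + \<Delta>)"
      by (rule contract_plus) (use IH LR in blast)
  qed
next
  fix \<Gamma> \<Delta>
  assume d: "derivable G \<Gamma> (add_mset C (add_mset C \<Delta>))"
  show "derivable G \<Gamma> (add_mset C \<Delta>)"
  proof (rule derivable_right[OF pC])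
    fix L R assume LR: "(L, R) \<in> right_premises C"
    have "derivable G (L + \<Gamma>) (add_mset C (R + \<Delta>))"
      using invert_right_add[OF d pC LR] by simp
    from invert_right_add[OF this pC LR] show "derivable G (L + \<Gamma>) (R + \<Delta>)"
      by (rule contract_plus) (use IH LR in blast)
  qed
qed

text \<open>Membership in \<open>\<Gamma> - {#C#}\<close> encodes two copies of \<open>C\<close>.
  Only a conditional rule can have both as principal formulas; since \<open>Cond\<close> is
  injective they come from equal pairs in \<open>M\<close>. Dropping one pair duplicates no work
  except in the main premise, where its second component has to be contracted.\<close>

lemma contract_left_nonpropositional:
  assumes "derivable G \<Gamma> \<Delta>" "C \<in># \<Gamma> - {#C#}" "\<not> propositional C"
    and IH: "\<And>A B. C = Cond A B \<Longrightarrow> contractible G B"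
  shows "derivable G (\<Gamma> - {#C#}) \<Delta>"
  using assms(1,2)
proof (induction rule: derivable_schema_induct)
  case (Ax p \<Gamma> \<Delta>)
  then have "Atm p \<in># add_mset (Atm p) \<Gamma> - {#C#}"
    by (cases "C = Atm p") auto
  then show ?case
    by (metis derivable.ax insert_DiffM)
next
  case (Left X \<Gamma> \<Delta>)
  then have "X \<noteq> C" using assms(3) by auto
  then have C: "C \<in># \<Gamma>" "C \<in># \<Gamma> - {#C#}"
    using Left(4) by (auto dest: in_diffD)
  have "derivable G (add_mset X (\<Gamma> - {#C#})) \<Delta>"
  proof (rule derivable_left[OF Left(1)])
    fix L R assume "(L, R) \<in> left_premises X"
    then show "derivable G (L + (\<Gamma> - {#C#})) (R + \<Delta>)"
      using Left(3) C(2) unfolding diff_union_single_conv[OF C(1)] by simp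
  qed
  then show ?case using \<open>X \<noteq> C\<close> by simp
next
  case (Right X \<Gamma> \<Delta>)
  then have C: "C \<in># \<Gamma>" by (auto dest: in_diffD)
  show ?case
  proof (rule derivable_right[OF Right(1)])
    fix L R assume "(L, R) \<in> right_premises X"
    then show "derivable G (L + (\<Gamma> - {#C#})) (R + \<Delta>)"
      using Right(3) Right(4) unfolding diff_union_single_conv[OF C] by simp
  qed
next
  case (LW X \<Gamma> \<Delta>)
  then show ?case
    by (cases "X = C") (auto intro: derivable.LW)
next
  case (RW X \<Gamma> \<Delta>)
  then show ?case by (simp add: derivable.RW)
next
  case (Cond M A B)
  from Cond(2) obtain N where N: "image_mset (case_prod Cond) M = add_mset C (add_mset C N)"
    by (metis in_diffD insert_DiffM)
  then obtain x M1 where x: "M = add_mset x M1" "case_prod Cond x = C"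
      "image_mset (case_prod Cond) M1 = add_mset C N"
    by (auto dest!: msed_map_invR)
  then obtain y M2 where y: "M1 = add_mset y M2" "case_prod Cond y = C"
      "image_mset (case_prod Cond) M2 = N"
    by (auto dest!: msed_map_invR)
  obtain A' B' where x_eq: "x = (A', B')" by (cases x)
  with x y have y_eq: "y = (A', B')" and C: "C = Cond A' B'" by (cases y; auto)+
  have "derivable G (add_mset B' (image_mset snd M2)) {#B#}"
    using Cond(1) IH[OF C] by (auto simp: cond_premises_def contractible_def x y x_eq y_eq)
  \<comment> \<open>\<open>M\<close> has at least two pairs, which forces \<open>has_CMC G\<close>;
    so the smaller, still nonempty \<open>M1\<close> has an admissible arity.\<close>
  then have "cond_premises G M1 A B"
    using Cond(1) by (auto simp: cond_premises_def cond_arity_def x y x_eq y_eq)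
  from derivable_cond[OF this] show ?case
    using x y C by (simp add: N)
qed

text \<open>A conditional rule has just one succedent formula, so two copies of \<open>C\<close>
  cannot both be principal, and subformulas need not be contracted.\<close>

lemma contract_right_nonpropositional:
  assumes "derivable G \<Gamma> \<Delta>" "C \<in># \<Delta> - {#C#}" "\<not> propositional C"
  shows "derivable G \<Gamma> (\<Delta> - {#C#})"
  using assms(1,2)
proof (induction rule: derivable_schema_induct)
  case (Ax p \<Gamma> \<Delta>)
  then have "Atm p \<in># add_mset (Atm p) \<Delta> - {#C#}"
    by (cases "C = Atm p") auto
  then show ?case
    by (metis derivable.ax insert_DiffM)
next
  case (Right X \<Gamma> \<Delta>)
  then have "X \<noteq> C" using assms(3) by auto
  then have C: "C \<in># \<Delta>" "C \<in># \<Delta> - {#C#}"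
    using Right(4) by (auto dest: in_diffD)
  have "derivable G \<Gamma> (add_mset X (\<Delta> - {#C#}))"
  proof (rule derivable_right[OF Right(1)])
    fix L R assume "(L, R) \<in> right_premises X"
    then show "derivable G (L + \<Gamma>) (R + (\<Delta> - {#C#}))"
      using Right(3) C(2) unfolding diff_union_single_conv[OF C(1)] by simp
  qed
  then show ?case using \<open>X \<noteq> C\<close> by simp
next
  case (Left X \<Gamma> \<Delta>)
  then have C: "C \<in># \<Delta>" by (auto dest: in_diffD)
  show ?case
  proof (rule derivable_left[OF Left(1)])
    fix L R assume "(L, R) \<in> left_premises X"
    then show "derivable G (L + \<Gamma>) (R + (\<Delta> - {#C#}))"
      using Left(3) Left(4) unfolding diff_union_single_conv[OF C] by simp
  qed
next
  case (RW X \<Gamma> \<Delta>)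
  then show ?case
    by (cases "X = C") (auto intro: derivable.RW)
next
  case (LW X \<Gamma> \<Delta>)
  then show ?case by (simp add: derivable.LW)
next
  case (Cond M A B)
  then show ?case by (cases "C = Cond A B") auto
qed

lemma contractible_nonpropositional:
  assumes "\<not> propositional C" "\<And>A B. C = Cond A B \<Longrightarrow> contractible G B"
  shows "contractible G C"
  unfolding contractible_def
proof (intro conjI allI impI)
  fix \<Gamma> \<Delta>
  assume "derivable G (add_mset C (add_mset C \<Gamma>)) \<Delta>"
  from contract_left_nonpropositional[OF this _ assms] show "derivable G (add_mset C \<Gamma>) \<Delta>"
    by simp
next
  fix \<Gamma> \<Delta>
  assume "derivable G \<Gamma> (add_mset C (add_mset C \<Delta>))"
  from contract_right_nonpropositional[OF this _ assms(1)] show "derivable G \<Gamma> (add_mset C \<Delta>)"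
    by simp
qed

lemma contractible: "contractible G C"
proof (induction C)
  case (Atm p)
  show ?case by (rule contractible_nonpropositional) (auto simp: propositional_def)
next
  case (Cond A B)
  show ?case by (rule contractible_nonpropositional) (use Cond in \<open>auto simp: propositional_def\<close>)
qed (rule contractible_propositional; auto simp: propositional_def)+

text \<open>Weakening reaches \<open>\<Gamma> + \<Gamma>'\<close> and
  \<open>\<Delta> + \<Delta>'\<close>; each formula of \<open>\<Gamma>\<close> has a copy in
  \<open>\<Gamma>'\<close>, likewise for \<open>\<Delta>\<close>, so contraction absorbs it.\<close>

lemma derivable_mono:
  assumes "derivable G \<Gamma> \<Delta>" "set_mset \<Gamma> \<subseteq> set_mset \<Gamma>'" "set_mset \<Delta> \<subseteq> set_mset \<Delta>'"
  shows "derivable G \<Gamma>' \<Delta>'"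
proof -
  have absorb_left: "derivable G \<Gamma>' \<Delta>"
    if "derivable G (\<Gamma> + \<Gamma>') \<Delta>" "set_mset \<Gamma> \<subseteq> set_mset \<Gamma>'" for \<Gamma> \<Gamma>' \<Delta> :: "'a fm multiset"
    using that
  proof (induction \<Gamma>)
    case (add C \<Gamma>)
    then obtain \<Gamma>'' where "\<Gamma> + \<Gamma>' = add_mset C \<Gamma>''"
      by (metis insert_DiffM insert_subset set_mset_add_mset_insert union_iff)
    then show ?case
      using add contractible[of G C] by (auto simp: contractible_def)
  qed simp
  have absorb_right: "derivable G \<Gamma> \<Delta>'"
    if "derivable G \<Gamma> (\<Delta> + \<Delta>')" "set_mset \<Delta> \<subseteq> set_mset \<Delta>'" for \<Gamma> \<Delta> \<Delta>' :: "'a fm multiset"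
    using that
  proof (induction \<Delta>)
    case (add C \<Delta>)
    then obtain \<Delta>'' where "\<Delta> + \<Delta>' = add_mset C \<Delta>''"
      by (metis insert_DiffM insert_subset set_mset_add_mset_insert union_iff)
    then show ?case
      using add contractible[of G C] by (auto simp: contractible_def)
  qed simp
  have "derivable G (\<Gamma> + \<Gamma>') (\<Delta> + \<Delta>')"
    using derivable_weaken_plus[OF assms(1), of \<Gamma>' \<Delta>'] by (simp add: ac_simps)
  then show ?thesis
    using absorb_left absorb_right assms(2,3) by blast
qed

text \<open>The principal formula stays in the premises, so a rule can be applied to contexts known
  only up to set inclusion.\<close>

lemma derivable_left_mem:
  assumes "propositional C" "C \<in># \<Gamma>"
    and "\<And>L R. (L, R) \<in> left_premises C \<Longrightarrow> derivable G (L + \<Gamma>) (R + \<Delta>)"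
  shows "derivable G \<Gamma> \<Delta>"
  using derivable_mono[OF derivable_left[OF assms(1,3)]] assms(2) by auto

lemma derivable_right_mem:
  assumes "propositional C" "C \<in># \<Delta>"
    and "\<And>L R. (L, R) \<in> right_premises C \<Longrightarrow> derivable G (L + \<Gamma>) (R + \<Delta>)"
  shows "derivable G \<Gamma> \<Delta>"
  using derivable_mono[OF derivable_right[OF assms(1,3)]] assms(2) by auto

section \<open>Cut admissibility\<close>

definition cuttable :: "calculus \<Rightarrow> 'a fm \<Rightarrow> bool" where
  "cuttable G C \<longleftrightarrow> (\<forall>\<Gamma> \<Delta>. derivable G \<Gamma> (add_mset C \<Delta>) \<longrightarrow> derivable G (add_mset C \<Gamma>) \<Delta> \<longrightarrow>
     derivable G \<Gamma> \<Delta>)"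

text \<open>Enlarging both derivations to the joint contexts turns the cut with separate contexts
  into the context-sharing one.\<close>

lemma cuttableD:
  assumes "cuttable G C" "derivable G \<Gamma>1 (add_mset C \<Delta>1)" "derivable G (add_mset C \<Gamma>2) \<Delta>2"
  shows "derivable G (\<Gamma>1 + \<Gamma>2) (\<Delta>1 + \<Delta>2)"
proof -
  have "derivable G (\<Gamma>1 + \<Gamma>2) (add_mset C (\<Delta>1 + \<Delta>2))"
    by (rule derivable_mono[OF assms(2)]) auto
  moreover have "derivable G (add_mset C (\<Gamma>1 + \<Gamma>2)) (\<Delta>1 + \<Delta>2)"
    by (rule derivable_mono[OF assms(3)]) auto
  ultimately show ?thesis
    using assms(1) by (simp add: cuttable_def)
qed

text \<open>This is the principal case for conditionals. All copies of \<open>(A, B)\<close> in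
  \<open>N\<close> are replaced by \<open>M\<close> at once. The equivalences compose by cuts on
  \<open>A\<close>; the main premises, and for (CE) the backward entailments, compose by cuts on
  \<open>B\<close>.\<close>

lemma cond_premises_cut:
  assumes M: "cond_premises G M A B" and N: "cond_premises G N E F" and AB: "(A, B) \<in># N"
    and cut: "cuttable G A" "cuttable G B"
  shows "cond_premises G (M + filter_mset ((\<noteq>) (A, B)) N) E F"
proof -
  define N' where "N' = filter_mset ((\<noteq>) (A, B)) N"
  \<comment> \<open>Without (CMC), \<open>N\<close> is a single pair and \<open>N'\<close> must be
    empty, leaving the arity of \<open>M\<close>. The strict decrease in size yields this.\<close>
  have "N' \<subseteq># N - {#(A, B)#}"
    using AB by (auto simp: N'_def subseteq_mset_def)
  then have "size N' < size N"
    using AB by (metis le_less_trans size_Diff1_less size_mset_mono)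
  then have arity: "cond_arity G (size (M + N'))"
    using M N unfolding cond_premises_def cond_arity_def size_union by linarith
  have AE: "derivable G {#A#} {#E#}" "derivable G {#E#} {#A#}"
    and FB: "has_CE G \<Longrightarrow> derivable G {#F#} {#B#}"
    using N AB by (auto simp: cond_premises_def)
  have eqvM: "derivable G {#E#} {#A'#} \<and> derivable G {#A'#} {#E#} \<and>
      (has_CE G \<longrightarrow> derivable G {#F#} {#B'#})" if "(A', B') \<in># M" for A' B'
  proof -
    have A': "derivable G {#A#} {#A'#}" "derivable G {#A'#} {#A#}"
      and B': "has_CE G \<Longrightarrow> derivable G {#B#} {#B'#}"
      using M that by (auto simp: cond_premises_def)
    show ?thesis
      using cuttableD[OF cut(1), of "{#E#}" "{#}" "{#}" "{#A'#}"]
        cuttableD[OF cut(1), of "{#A'#}" "{#}" "{#}" "{#E#}"]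
        cuttableD[OF cut(2), of "{#F#}" "{#}" "{#}" "{#B'#}"] AE FB A' B' by simp
  qed
  have eqvN: "derivable G {#E#} {#A'#} \<and> derivable G {#A'#} {#E#} \<and>
      (has_CE G \<longrightarrow> derivable G {#F#} {#B'#})" if "(A', B') \<in># N'" for A' B'
    using N that by (auto simp: cond_premises_def N'_def)
  have "derivable G (image_mset snd N) {#F#}"
    using N by (simp add: cond_premises_def)
  \<comment> \<open>The removed pairs contribute only copies of \<open>B\<close>, which merge into
    one because contexts count as sets.\<close>
  then have "derivable G (add_mset B (image_mset snd N')) {#F#}"
    by (rule derivable_mono) (force simp: N'_def)+
  moreover have "derivable G (image_mset snd M) {#B#}"
    using M by (simp add: cond_premises_def)
  ultimately have "derivable G (image_mset snd (M + N')) {#F#}"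
    using cuttableD[OF cut(2), of "image_mset snd M" "{#}"] by simp
  with arity eqvM eqvN show ?thesis
    unfolding cond_premises_def N'_def[symmetric] by auto
qed

text \<open>The left derivation is frozen as the rule instance \<open>M\<close>, whose conditionals
  lie in \<open>\<Gamma>\<close>. Induction on the right derivation ends either at a conditional
  rule that uses \<open>Cond A B\<close>, where the two instances compose, or at a sequent that
  needs no cut. The inclusions let \<open>\<Gamma>\<close> and \<open>\<Delta>\<close> grow towards
  the premises.\<close>

lemma cut_cond_right:
  assumes "derivable G \<Gamma>2 \<Delta>2"
    and "set_mset \<Gamma>2 \<subseteq> insert (Cond A B) (set_mset \<Gamma>)" "set_mset \<Delta>2 \<subseteq> set_mset \<Delta>"
    and "case_prod Cond ` set_mset M \<subseteq> set_mset \<Gamma>"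
    and M: "cond_premises G M A B" and cut: "cuttable G A" "cuttable G B"
  shows "derivable G \<Gamma> \<Delta>"
  using assms(1-4)
proof (induction arbitrary: \<Gamma> \<Delta> rule: derivable_schema_induct)
  case (Ax p \<Gamma>2 \<Delta>2)
  have "derivable G {#Atm p#} {#Atm p#}"
    using derivable.ax[of G p "{#}" "{#}"] by simp
  then show ?case
    by (rule derivable_mono) (use Ax in auto)
next
  case (Left X \<Gamma>2 \<Delta>2)
  then have "X \<in># \<Gamma>" by (auto simp: propositional_def)
  with Left(1) show ?case
  proof (rule derivable_left_mem)
    fix L R assume "(L, R) \<in> left_premises X"
    then show "derivable G (L + \<Gamma>) (R + \<Delta>)"
      by (rule Left(3)) (use Left(4-) in auto)
  qed
next
  case (Right X \<Gamma>2 \<Delta>2)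
  then have "X \<in># \<Delta>" by auto
  with Right(1) show ?case
  proof (rule derivable_right_mem)
    fix L R assume "(L, R) \<in> right_premises X"
    then show "derivable G (L + \<Gamma>) (R + \<Delta>)"
      by (rule Right(3)) (use Right(4-) in auto)
  qed
next
  case (Cond N E F)
  show ?case
  proof (cases "(A, B) \<in># N")
    case True
    show ?thesis
      by (rule derivable_mono[OF derivable_cond[OF cond_premises_cut[OF M Cond(1) True cut]]])
        (use Cond(2-) in auto)
  next
    case False
    show ?thesis
      by (rule derivable_mono[OF derivable_cond[OF Cond(1)]]) (use Cond(2-) False in auto)
  qed
next
  case (LW X \<Gamma>2 \<Delta>2)
  show ?case by (rule LW(2)) (use LW(3-) in auto)
next
  case (RW X \<Gamma>2 \<Delta>2)
  show ?case by (rule RW(2)) (use RW(3-) in auto)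
qed

text \<open>Induction on the left derivation, with the right one weakened along, stops where
  \<open>C\<close> becomes principal. Propositional rules never introduce \<open>C\<close>, so they
  are permuted below the cut.\<close>

lemma cut_nonpropositional:
  assumes "derivable G \<Gamma>1 \<Delta>1"
    and "set_mset \<Gamma>1 \<subseteq> set_mset \<Gamma>" "set_mset \<Delta>1 \<subseteq> insert C (set_mset \<Delta>)"
    and "derivable G (add_mset C \<Gamma>) \<Delta>"
    and C: "\<not> propositional C"
    and cut: "\<And>A B. C = Cond A B \<Longrightarrow> cuttable G A \<and> cuttable G B"
  shows "derivable G \<Gamma> \<Delta>"
  using assms(1-4)
proof (induction arbitrary: \<Gamma> \<Delta> rule: derivable_schema_induct)
  case (Ax p \<Gamma>1 \<Delta>1)
  show ?case
  proof (cases "C = Atm p")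
    case True
    \<comment> \<open>Here \<open>Atm p\<close> already lies in \<open>\<Gamma>\<close>, so the
      right derivation absorbs its extra copy.\<close>
    show ?thesis
      by (rule derivable_mono[OF Ax(3)]) (use Ax True in auto)
  next
    case False
    have "derivable G {#Atm p#} {#Atm p#}"
      using derivable.ax[of G p "{#}" "{#}"] by simp
    then show ?thesis
      by (rule derivable_mono) (use Ax False in auto)
  qed
next
  case (Left X \<Gamma>1 \<Delta>1)
  then have "X \<in># \<Gamma>" by auto
  with Left(1) show ?case
  proof (rule derivable_left_mem)
    fix L R assume LR: "(L, R) \<in> left_premises X"
    have "derivable G (add_mset C (L + \<Gamma>)) (R + \<Delta>)"
      by (rule derivable_mono[OF Left(6)]) auto
    from Left(3)[OF LR _ _ this] show "derivable G (L + \<Gamma>) (R + \<Delta>)"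
      using Left(4,5) by auto
  qed
next
  case (Right X \<Gamma>1 \<Delta>1)
  then have "X \<in># \<Delta>" using C by auto
  with Right(1) show ?case
  proof (rule derivable_right_mem)
    fix L R assume LR: "(L, R) \<in> right_premises X"
    have "derivable G (add_mset C (L + \<Gamma>)) (R + \<Delta>)"
      by (rule derivable_mono[OF Right(6)]) auto
    from Right(3)[OF LR _ _ this] show "derivable G (L + \<Gamma>) (R + \<Delta>)"
      using Right(4,5) by auto
  qed
next
  case (Cond M A B)
  show ?case
  proof (cases "C = Cond A B")
    case True
    show ?thesis
      by (rule cut_cond_right[OF Cond(4) _ _ _ Cond(1)]) (use Cond(2) cut True in auto)
  next
    case False
    show ?thesis
      by (rule derivable_mono[OF derivable_cond[OF Cond(1)]]) (use Cond(2,3) False in auto)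
  qed
next
  case (LW X \<Gamma>1 \<Delta>1)
  show ?case by (rule LW(2)) (use LW(3-) in auto)
next
  case (RW X \<Gamma>1 \<Delta>1)
  show ?case by (rule RW(2)) (use RW(3-) in auto)
qed

lemma cuttable_nonpropositional:
  assumes "\<not> propositional C" "\<And>A B. C = Cond A B \<Longrightarrow> cuttable G A \<and> cuttable G B"
  shows "cuttable G C"
  unfolding cuttable_def
proof (intro allI impI)
  fix \<Gamma> \<Delta>
  assume l: "derivable G \<Gamma> (add_mset C \<Delta>)" and r: "derivable G (add_mset C \<Gamma>) \<Delta>"
  show "derivable G \<Gamma> \<Delta>"
    by (rule cut_nonpropositional[OF l _ _ r assms]) simp_all
qed

lemma cuttable_Conj:
  assumes "cuttable G A" "cuttable G B"
  shows "cuttable G (Conj A B)"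
  unfolding cuttable_def
proof (intro allI impI)
  fix \<Gamma> \<Delta>
  assume l: "derivable G \<Gamma> (add_mset (Conj A B) \<Delta>)" and r: "derivable G (add_mset (Conj A B) \<Gamma>) \<Delta>"
  have "derivable G \<Gamma> (add_mset A \<Delta>)" "derivable G \<Gamma> (add_mset B \<Delta>)"
    using invert_right_add[OF l, of "{#}" "{#A#}"] invert_right_add[OF l, of "{#}" "{#B#}"]
    by (auto simp: propositional_def)
  moreover have "derivable G (add_mset A (add_mset B \<Gamma>)) \<Delta>"
    using invert_left_add[OF r, of "{#A, B#}" "{#}"] by (auto simp: propositional_def add_mset_commute)
  \<comment> \<open>Weakening by \<open>B\<close> matches the contexts for the cut on
    \<open>A\<close>; a cut on \<open>B\<close> follows.\<close>
  ultimately show "derivable G \<Gamma> \<Delta>"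
    using assms derivable.LW[of G \<Gamma> "add_mset A \<Delta>" B] unfolding cuttable_def by blast
qed

lemma cuttable_Disj:
  assumes "cuttable G A" "cuttable G B"
  shows "cuttable G (Disj A B)"
  unfolding cuttable_def
proof (intro allI impI)
  fix \<Gamma> \<Delta>
  assume l: "derivable G \<Gamma> (add_mset (Disj A B) \<Delta>)" and r: "derivable G (add_mset (Disj A B) \<Gamma>) \<Delta>"
  have "derivable G (add_mset A \<Gamma>) \<Delta>" "derivable G (add_mset B \<Gamma>) \<Delta>"
    using invert_left_add[OF r, of "{#A#}" "{#}"] invert_left_add[OF r, of "{#B#}" "{#}"]
    by (auto simp: propositional_def)
  moreover have "derivable G \<Gamma> (add_mset A (add_mset B \<Delta>))"
    using invert_right_add[OF l, of "{#}" "{#A, B#}"] by (auto simp: propositional_def add_mset_commute)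
  \<comment> \<open>Cut on \<open>A\<close> with \<open>B\<close> carried in the succedent, then cut
    on \<open>B\<close>.\<close>
  ultimately show "derivable G \<Gamma> \<Delta>"
    using assms derivable.RW[of G "add_mset A \<Gamma>" \<Delta> B] unfolding cuttable_def by blast
qed

lemma cuttable_Imp:
  assumes "cuttable G A" "cuttable G B"
  shows "cuttable G (Imp A B)"
  unfolding cuttable_def
proof (intro allI impI)
  fix \<Gamma> \<Delta>
  assume l: "derivable G \<Gamma> (add_mset (Imp A B) \<Delta>)" and r: "derivable G (add_mset (Imp A B) \<Gamma>) \<Delta>"
  have "derivable G \<Gamma> (add_mset A \<Delta>)" "derivable G (add_mset B \<Gamma>) \<Delta>"
    using invert_left_add[OF r, of "{#}" "{#A#}"] invert_left_add[OF r, of "{#B#}" "{#}"]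
    by (auto simp: propositional_def)
  moreover have "derivable G (add_mset A \<Gamma>) (add_mset B \<Delta>)"
    using invert_right_add[OF l, of "{#A#}" "{#B#}"] by (auto simp: propositional_def)
  \<comment> \<open>Cut on \<open>B\<close> with \<open>A\<close> carried in the antecedent, then
    cut on \<open>A\<close>.\<close>
  ultimately show "derivable G \<Gamma> \<Delta>"
    using assms derivable.LW[of G "add_mset B \<Gamma>" \<Delta> A] unfolding cuttable_def
    by (metis add_mset_commute)
qed

lemma cuttable: "cuttable G C"
proof (induction C)
  case (Atm p)
  show ?case by (rule cuttable_nonpropositional) (auto simp: propositional_def)
next
  case Bot
  have "derivable G \<Gamma> \<Delta>" if "derivable G \<Gamma> (add_mset Bot \<Delta>)" for \<Gamma> \<Delta>
    using invert_right_add[OF that, of "{#}" "{#}"] by (simp add: propositional_def)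
  then show ?case unfolding cuttable_def by blast
next
  case (Cond A B)
  show ?case by (rule cuttable_nonpropositional) (use Cond in \<open>auto simp: propositional_def\<close>)
qed (simp_all add: cuttable_Conj cuttable_Disj cuttable_Imp)

theorem mainTheorem2:
  fixes G :: calculus and \<phi> :: "'a fm"
    and \<Gamma>1 \<Gamma>2 \<Delta>1 \<Delta>2 :: "'a fm multiset"
  assumes "derivable G \<Gamma>1 (add_mset \<phi> \<Delta>1)"
    and "derivable G (add_mset \<phi> \<Gamma>2) \<Delta>2"
  shows "derivable G (\<Gamma>1 + \<Gamma>2) (\<Delta>1 + \<Delta>2)"
  using cuttableD[OF cuttable assms] .

end
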